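(* Let $\mathcal P=(L,\mathcal T,\mathcal W)$ and $\widehat{\mathcal P}=(L,\widehat{\mathcal T},\widehat{\mathcal W})$ be two variational principles on the same $\mathrm TQ$ with the same Lagrangian $L$. Consider an extremal $\gamma\in\Gamma_{\mathcal P}\cap\widehat{\mathcal T}$. Assume that for every variation $\widehat\delta\gamma\in\widehat{\mathcal W}^0_\gamma$ there exists a variation $\delta\gamma\in\mathcal W^0_\gamma$ such that $\widehat\delta\gamma(t)-\delta\gamma(t)\in(\ker\mathrm dL)_{\gamma(t)}$ for every $t\in[t_0,t_1]$. Then $$\gamma\in\Gamma_{\widehat{\mathcal P}} .$$
   Context: Let $Q$ be a smooth manifold, $\tau_Q:\mathrm TQ\to Q$ its tangent bundle and $I=[t_0,t_1]$ a fixed interval. A variational principle on $\mathrm TQ$ is a triple $\mathcal P=(L,\mathcal T,\mathcal W)$ consisting of a smooth Lagrangian $L:\mathrm TQ\to\mathbb R$, a set of admissible paths $\mathcal T\subset C^\infty(I,\mathrm TQ)$, and a set of admissible variations $\mathcal W\subset C^\infty(I,\mathrm{TT}Q)$ along admissible paths (a variation along $\gamma$ is a curve $\delta\gamma:I\to\mathrm{TT}Q$ with $\delta\gamma(t)\in\mathrm T_{\gamma(t)}\mathrm TQ$). $\mathcal W_\gamma$ denotes the admissible variations along $\gamma\in\mathcal T$, and $\mathcal W^0_\gamma\subset\mathcal W_\gamma$ those with vanishing end-points, i.e. such that $\mathrm T\tau_Q(\delta\gamma(t))$ vanishes at $t=t_0$ and $t=t_1$. Put $\langle\mathrm dS_L(\gamma),\delta\gamma\rangle:=\int_I\langle\mathrm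 dL(\gamma(t)),\delta\gamma(t)\rangle\,\mathrm dt$. A path $\gamma\in\mathcal T$ is an extremal of $\mathcal P$ if $\langle\mathrm dS_L(\gamma),\delta\gamma\rangle=0$ for every $\delta\gamma\in\mathcal W^0_\gamma$; $\Gamma_{\mathcal P}\subset\mathcal T$ is the set of all extremals of $\mathcal P$. Differences of variations are taken in the vector spaces $\mathrm T_{\gamma(t)}\mathrm TQ$. *)

theory Defs
  imports "HOL-Analysis.Analysis"
begin

section \<open>Smooth manifolds\<close>

text \<open>
  \<open>C\<^sup>k\<close> and \<open>C\<^sup>\<infinity>\<close> maps on an \<^emph>\<open>open\<close> subset of a finite-dimensional space. In finite dimension,
  continuity of \<open>x \<mapsto> Df(x) v\<close> for each \<open>v\<close> is the same as continuity of \<open>x \<mapsto> Df(x)\<close>.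
\<close>

primrec Ck_on ::
  "nat \<Rightarrow> 'b::real_normed_vector set \<Rightarrow> ('b \<Rightarrow> 'c::real_normed_vector) \<Rightarrow> bool" where
  "Ck_on 0 S f \<longleftrightarrow> continuous_on S f"
| "Ck_on (Suc k) S f \<longleftrightarrow> (\<forall>x\<in>S. f differentiable (at x)) \<and>
     (\<forall>v. Ck_on k S (\<lambda>x. frechet_derivative f (at x) v))"

definition smooth_on :: "'b::real_normed_vector set \<Rightarrow> ('b \<Rightarrow> 'c::real_normed_vector) \<Rightarrow> bool" where
  "smooth_on S f \<longleftrightarrow> (\<forall>k. Ck_on k S f)"

text \<open>
  A manifold is given by an atlas \<open>A\<close> of charts \<open>(U, \<phi>)\<close>: its points are the union of the domains
  \<open>U\<close>, and its topology is the one making all charts homeomorphisms onto open sets. The values of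
  \<open>\<phi>\<close> outside \<open>U\<close> are irrelevant. The model space is a finite-dimensional inner product space
  instead of a type of class \<^class>\<open>euclidean_space\<close>, because the latter excludes dimension 0.
\<close>

type_synonym ('a, 'e) atlas = "('a set \<times> ('a \<Rightarrow> 'e)) set"

definition points :: "('a, 'e) atlas \<Rightarrow> 'a set" where
  "points A = (\<Union>(U, \<phi>)\<in>A. U)"

definition manifold_topology :: "('a, 'e::real_inner) atlas \<Rightarrow> 'a topology" where
  "manifold_topology A =
     topology (\<lambda>W. W \<subseteq> points A \<and> (\<forall>(U, \<phi>)\<in>A. open (\<phi> ` (U \<inter> W))))"

definition smooth_manifold :: "('a, 'e::real_inner) atlas \<Rightarrow> bool" where
  "smooth_manifold A \<longleftrightarrow>
     (\<exists>B::'e set. finite B \<and> span B = UNIV) \<and>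
     (\<forall>(U, \<phi>)\<in>A. inj_on \<phi> U) \<and>
     (\<forall>(U, \<phi>)\<in>A. \<forall>(V, \<psi>)\<in>A.
        open (\<phi> ` (U \<inter> V)) \<and> smooth_on (\<phi> ` (U \<inter> V)) (\<psi> \<circ> inv_into U \<phi>)) \<and>
     Hausdorff_space (manifold_topology A) \<and>
     second_countable (manifold_topology A)"

lemma openin_manifold_topology:
  assumes "\<And>U \<phi>. (U, \<phi>) \<in> A \<Longrightarrow> inj_on \<phi> U"
  shows "openin (manifold_topology A) W \<longleftrightarrow>
    W \<subseteq> points A \<and> (\<forall>(U, \<phi>)\<in>A. open (\<phi> ` (U \<inter> W)))"
proof -
  let ?P = "\<lambda>W. W \<subseteq> points A \<and> (\<forall>(U, \<phi>)\<in>A. open (\<phi> ` (U \<inter> W)))"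
  have "istopology ?P"
    unfolding istopology_def
  proof (intro conjI allI impI)
    fix S T assume S: "?P S" and T: "?P T"
    have "open (\<phi> ` (U \<inter> (S \<inter> T)))" if "(U, \<phi>) \<in> A" for U \<phi>
    proof -
      have "\<phi> ` (U \<inter> (S \<inter> T)) = \<phi> ` (U \<inter> S) \<inter> \<phi> ` (U \<inter> T)"
        using assms[OF that] by (auto simp: inj_on_def)
      then show ?thesis using S T that by (auto intro!: open_Int)
    qed
    then show "S \<inter> T \<subseteq> points A" "\<forall>(U, \<phi>)\<in>A. open (\<phi> ` (U \<inter> (S \<inter> T)))"
      using S by auto
  next
    fix K assume K: "\<forall>S\<in>K. ?P S"
    have "open (\<phi> ` (U \<inter> \<Union>K))" if "(U, \<phi>) \<in> A" for U \<phi>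
    proof -
      have "\<phi> ` (U \<inter> \<Union>K) = (\<Union>S\<in>K. \<phi> ` (U \<inter> S))" by auto
      then show ?thesis using K that by (auto intro!: open_UN)
    qed
    then show "\<Union>K \<subseteq> points A" "\<forall>(U, \<phi>)\<in>A. open (\<phi> ` (U \<inter> \<Union>K))"
      using K by auto
  qed
  then show ?thesis
    unfolding manifold_topology_def by (simp add: topology_inverse')
qed

definition smooth_at ::
  "('a, 'e::real_inner) atlas \<Rightarrow> 'a \<Rightarrow> ('a \<Rightarrow> real) \<Rightarrow> bool" where
  "smooth_at A p f \<longleftrightarrow> (\<exists>(U, \<phi>)\<in>A. p \<in> U \<and>
     (\<exists>S. open S \<and> S \<subseteq> \<phi> ` U \<and> \<phi> p \<in> S \<and> smooth_on S (f \<circ> inv_into U \<phi>)))"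

definition smooth_function :: "('a, 'e::real_inner) atlas \<Rightarrow> ('a \<Rightarrow> real) \<Rightarrow> bool" where
  "smooth_function A f \<longleftrightarrow> (\<forall>p\<in>points A. smooth_at A p f)"

text \<open>
  The set \<open>C\<^sup>\<infinity>([t\<^sub>0, t\<^sub>1], M)\<close>. Smoothness on the closed interval means that, in a chart, the curve
  extends near each point to a smooth curve on an open set. Curves are \<^const>\<open>undefined\<close> outside the
  interval, so that they are determined by their values on it.
\<close>

definition smooth_curves :: "('a, 'e::real_inner) atlas \<Rightarrow> real \<Rightarrow> real \<Rightarrow> (real \<Rightarrow> 'a) set" where
  "smooth_curves A t0 t1 = {\<gamma> \<in> {t0..t1} \<rightarrow>\<^sub>E points A.
     \<forall>t\<in>{t0..t1}. \<exists>(U, \<phi>)\<in>A. \<exists>J g. open J \<and> t \<in> J \<and> smooth_on J g \<and>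
       (\<forall>s\<in>J \<inter> {t0..t1}. \<gamma> s \<in> U \<and> g s = \<phi> (\<gamma> s))}"

section \<open>Tangent bundles\<close>

text \<open>
  Tangent vectors at \<open>p\<close> are the derivations at \<open>p\<close> of germs of smooth functions. A derivation acts
  on functions that are smooth near \<open>p\<close>, depends only on their germs, and is set to 0 on all other
  functions so that equality of tangent vectors is equality of derivations. Elements of the tangent
  bundle are pairs of a base point and a tangent vector there; the vector space operations on
  each fibre are pointwise.
\<close>

type_synonym 'a tangent = "'a \<times> (('a \<Rightarrow> real) \<Rightarrow> real)"

definition tangent_space ::
  "('a, 'e::real_inner) atlas \<Rightarrow> 'a \<Rightarrow> (('a \<Rightarrow> real) \<Rightarrow> real) set" where
  "tangent_space A p = {v.
     (\<forall>f. \<not> smooth_at A p f \<longrightarrow> v f = 0) \<and>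
     (\<forall>f g W. smooth_at A p f \<and> smooth_at A p g \<and> openin (manifold_topology A) W \<and> p \<in> W \<and>
        (\<forall>q\<in>W. f q = g q) \<longrightarrow> v f = v g) \<and>
     (\<forall>f g a b. smooth_at A p f \<and> smooth_at A p g \<longrightarrow>
        v (\<lambda>q. a * f q + b * g q) = a * v f + b * v g) \<and>
     (\<forall>f g. smooth_at A p f \<and> smooth_at A p g \<longrightarrow>
        v (\<lambda>q. f q * g q) = f p * v g + g p * v f)}"

text \<open>
  The chart of the tangent bundle induced by \<open>(U, \<phi>)\<close> sends \<open>(p, v)\<close> to \<open>(\<phi> p, v \<phi>)\<close>, where the
  derivation \<open>v\<close> is applied to the vector-valued function \<open>\<phi>\<close>: the result is the vector \<open>e\<close> whose
  component in direction \<open>x\<close> is the derivative of the corresponding component of \<open>\<phi>\<close>.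
  The resulting atlas can be fed into \<open>tangent_atlas\<close> again, which gives the double tangent bundle.
\<close>

definition tangent_chart ::
  "('a, 'e::real_inner) atlas \<Rightarrow> 'a set \<times> ('a \<Rightarrow> 'e) \<Rightarrow>
     'a tangent set \<times> ('a tangent \<Rightarrow> 'e \<times> 'e)" where
  "tangent_chart A = (\<lambda>(U, \<phi>).
     ({(p, v). p \<in> U \<and> v \<in> tangent_space A p},
      \<lambda>(p, v). (\<phi> p, THE e. \<forall>x. e \<bullet> x = v (\<lambda>q. \<phi> q \<bullet> x))))"

definition tangent_atlas :: "('a, 'e::real_inner) atlas \<Rightarrow> ('a tangent, 'e \<times> 'e) atlas" where
  "tangent_atlas A = tangent_chart A ` A"

definition bundle_projection :: "'a tangent \<Rightarrow> 'a" where
  "bundle_projection w = fst w"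

definition zero_vector :: "'a \<Rightarrow> 'a tangent" where
  "zero_vector p = (p, \<lambda>f. 0)"

text \<open>Only meaningful for tangent vectors over the same base point.\<close>

definition tangent_minus :: "'a tangent \<Rightarrow> 'a tangent \<Rightarrow> 'a tangent" where
  "tangent_minus w w' = (fst w, \<lambda>f. snd w f - snd w' f)"

text \<open>The tangent map (pushforward) of a map \<open>F\<close> into the manifold with atlas \<open>B\<close>.\<close>

definition tangent_map ::
  "('b, 'e::real_inner) atlas \<Rightarrow> ('a \<Rightarrow> 'b) \<Rightarrow> 'a tangent \<Rightarrow> 'b tangent" where
  "tangent_map B F = (\<lambda>(p, v).
     (F p, \<lambda>g. if smooth_at B (F p) g then v (\<lambda>q. g (F q)) else 0))"

definition differential :: "('a \<Rightarrow> real) \<Rightarrow> 'a tangent \<Rightarrow> real" where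
  "differential f w = snd w f"

definition differential_kernel ::
  "('a, 'e::real_inner) atlas \<Rightarrow> ('a \<Rightarrow> real) \<Rightarrow> 'a \<Rightarrow> 'a tangent set" where
  "differential_kernel A f p =
     {w. bundle_projection w = p \<and> snd w \<in> tangent_space A p \<and> differential f w = 0}"

section \<open>Variational principles\<close>

text \<open>
  Throughout, \<open>A\<close> is an atlas of \<open>Q\<close>, so that \<open>tangent_atlas A\<close> is the atlas of \<open>TQ\<close> and
  \<open>tangent_atlas (tangent_atlas A)\<close> the one of \<open>TTQ\<close>.
\<close>

definition variations_along ::
  "real \<Rightarrow> real \<Rightarrow> (real \<Rightarrow> 'a tangent tangent) set \<Rightarrow> (real \<Rightarrow> 'a tangent) \<Rightarrow>
     (real \<Rightarrow> 'a tangent tangent) set" where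
  "variations_along t0 t1 \<W> \<gamma> =
     {\<delta> \<in> \<W>. \<forall>t\<in>{t0..t1}. bundle_projection (\<delta> t) = \<gamma> t}"

definition variational_principle ::
  "('a, 'e::real_inner) atlas \<Rightarrow> real \<Rightarrow> real \<Rightarrow> ('a tangent \<Rightarrow> real) \<Rightarrow>
     (real \<Rightarrow> 'a tangent) set \<Rightarrow> (real \<Rightarrow> 'a tangent tangent) set \<Rightarrow> bool" where
  "variational_principle A t0 t1 L \<T> \<W> \<longleftrightarrow>
     smooth_function (tangent_atlas A) L \<and>
     \<T> \<subseteq> smooth_curves (tangent_atlas A) t0 t1 \<and>
     \<W> \<subseteq> smooth_curves (tangent_atlas (tangent_atlas A)) t0 t1 \<and>
     (\<forall>\<delta>\<in>\<W>. \<exists>\<gamma>\<in>\<T>. \<delta> \<in> variations_along t0 t1 \<W> \<gamma>)"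

definition vanishes_at_endpoint ::
  "('a, 'e::real_inner) atlas \<Rightarrow> 'a tangent tangent \<Rightarrow> bool" where
  "vanishes_at_endpoint A w \<longleftrightarrow>
     tangent_map A bundle_projection w = zero_vector (bundle_projection (bundle_projection w))"

definition variations0_along ::
  "('a, 'e::real_inner) atlas \<Rightarrow> real \<Rightarrow> real \<Rightarrow> (real \<Rightarrow> 'a tangent tangent) set \<Rightarrow>
     (real \<Rightarrow> 'a tangent) \<Rightarrow> (real \<Rightarrow> 'a tangent tangent) set" where
  "variations0_along A t0 t1 \<W> \<gamma> =
     {\<delta> \<in> variations_along t0 t1 \<W> \<gamma>.
        vanishes_at_endpoint A (\<delta> t0) \<and> vanishes_at_endpoint A (\<delta> t1)}"

text \<open>
  The pairing \<open>\<langle>dS\<^sub>L(\<gamma>), \<delta>\<gamma>\<rangle>\<close>; the path \<open>\<gamma>\<close> is implicit, being the base curve of \<open>\<delta>\<close>.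
\<close>

definition action_differential ::
  "real \<Rightarrow> real \<Rightarrow> ('a tangent \<Rightarrow> real) \<Rightarrow> (real \<Rightarrow> 'a tangent tangent) \<Rightarrow> real" where
  "action_differential t0 t1 L \<delta> = integral {t0..t1} (\<lambda>t. differential L (\<delta> t))"

definition extremals ::
  "('a, 'e::real_inner) atlas \<Rightarrow> real \<Rightarrow> real \<Rightarrow> ('a tangent \<Rightarrow> real) \<Rightarrow>
     (real \<Rightarrow> 'a tangent) set \<Rightarrow> (real \<Rightarrow> 'a tangent tangent) set \<Rightarrow>
     (real \<Rightarrow> 'a tangent) set" where
  "extremals A t0 t1 L \<T> \<W> =
     {\<gamma> \<in> \<T>. \<forall>\<delta>\<in>variations0_along A t0 t1 \<W> \<gamma>. action_differential t0 t1 L \<delta> = 0}"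

end

theory Submission
  imports Defs
begin

text \<open>
  Being an extremal only involves the numbers \<open>\<langle>dL(\<gamma>(t)), \<delta>\<gamma>(t)\<rangle>\<close>, and on a fibre these are linear
  in \<open>\<delta>\<gamma>(t)\<close>. Changing a variation by elements of the kernel of \<open>dL\<close> therefore leaves the action
  differential unchanged, so each condition imposed by the second principle is one imposed by
  the first.
\<close>

lemma differential_tangent_minus:
  "differential f (tangent_minus w w') = differential f w - differential f w'"
  by (simp add: differential_def tangent_minus_def)

lemma action_differential_eq_if_diff_in_kernel:
  assumes "\<forall>t\<in>{t0..t1}. tangent_minus (\<delta>' t) (\<delta> t) \<in> differential_kernel B L (\<gamma> t)"
  shows "action_differential t0 t1 L \<delta>' = action_differential t0 t1 L \<delta>"
  unfolding action_differential_def
proof (rule integral_cong)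
  fix t assume "t \<in> {t0..t1}"
  with assms have "differential L (tangent_minus (\<delta>' t) (\<delta> t)) = 0"
    by (simp add: differential_kernel_def)
  then show "differential L (\<delta>' t) = differential L (\<delta> t)"
    by (simp add: differential_tangent_minus)
qed

theorem proposition3p11:
  fixes A :: "('a, 'e::real_inner) atlas"
    and t0 t1 :: real
    and L :: "'a tangent \<Rightarrow> real"
    and \<T> \<T>' :: "(real \<Rightarrow> 'a tangent) set"
    and \<W> \<W>' :: "(real \<Rightarrow> 'a tangent tangent) set"
    and \<gamma> :: "real \<Rightarrow> 'a tangent"
  assumes "smooth_manifold A"
    and "t0 < t1"
    and "variational_principle A t0 t1 L \<T> \<W>"
    and "variational_principle A t0 t1 L \<T>' \<W>'"
    and "\<gamma> \<in> extremals A t0 t1 L \<T> \<W> \<inter> \<T>'"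
    and "\<forall>\<delta>'\<in>variations0_along A t0 t1 \<W>' \<gamma>. \<exists>\<delta>\<in>variations0_along A t0 t1 \<W> \<gamma>.
           \<forall>t\<in>{t0..t1}. tangent_minus (\<delta>' t) (\<delta> t)
             \<in> differential_kernel (tangent_atlas A) L (\<gamma> t)"
  shows "\<gamma> \<in> extremals A t0 t1 L \<T>' \<W>'"
  unfolding extremals_def
proof (intro CollectI conjI ballI)
  show "\<gamma> \<in> \<T>'"
    using assms(5) by blast
next
  fix \<delta>' assume "\<delta>' \<in> variations0_along A t0 t1 \<W>' \<gamma>"
  with assms(6) obtain \<delta> where \<delta>: "\<delta> \<in> variations0_along A t0 t1 \<W> \<gamma>"
    and "\<forall>t\<in>{t0..t1}. tangent_minus (\<delta>' t) (\<delta> t)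
           \<in> differential_kernel (tangent_atlas A) L (\<gamma> t)"
    by blast
  then have "action_differential t0 t1 L \<delta>' = action_differential t0 t1 L \<delta>"
    by (intro action_differential_eq_if_diff_in_kernel)
  also have "\<dots> = 0"
    using assms(5) \<delta> by (simp add: extremals_def)
  finally show "action_differential t0 t1 L \<delta>' = 0" .
qed

end
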